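(* Consider a sortition instance with nonempty set of panels $\mathcal P$ and target selection probabilities $\pi\in\mathrm{ri}(\mathcal M)$, the relative interior of the polytope $\mathcal M$ of selection probabilities. Run FairMaxEntropy (defined in the context) for $T$ iterations, and let $\lambda$ be the panel distribution obtained from the last iterate. Then $\lambda$ is an optimal solution of the program $$\max\ H(\lambda')\quad\text{s.t.}\quad \pi_{\lambda'}=\pi_\lambda,\ \ \lambda'\in\Delta(\mathcal P)$$ (that is, $\lambda$ is the maximum-entropy panel distribution subject to its own selection probabilities), and $$\mathbb E\big[\|\pi_\lambda-\pi\|_2^2\big]\le O(1/\sqrt T),$$ where the constant hidden in $O(\cdot)$ does not depend on $T$ (it may depend on the instance, on $\pi$, and on the parameters of the method other than $T$).
   Context: Sortition instance: pool members $N=\{1,\dots,n\}$; a finite set $F$ of features, each a function $f:N\to V_f$ to a finite set; a panel size $k$; integer quotas $0\le \ell_{f,v}\le u_{f,v}\le k$ for all $f\in F$, $v\in V_f$. A panel is a set $P\subseteq N$ with $|P|=k$ and $\ell_{f,v}\le|\{i\in P: f(i)=v\}|\le u_{f,v}$ for all $f,v$; $\mathcal P$ is the set of panels and $\Delta(\mathcal P)$ the set of probability distributions on $\mathcal P$. For $\lambda\in\Delta(\mathcal P)$, $\pi_\lambda\in[0,1]^N$ is given by $\pi_\lambda(i)=\sum_{P\in\mathcal P: i\in P}\lambda(P)$, and $H(\lambda)=-\sum_{P}\lambda(P)\log\lambda(P)$ is the Shannon entropy. $\mathcal M=\{\pi_\lambda:\lambda\in\Delta(\mathcal P)\}$. For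 $\theta\in\mathbb R^N$ let $\lambda_{e^\theta}\in\Delta(\mathcal P)$ be given by $\lambda_{e^\theta}(P)=\exp(\sum_{i\in P}\theta(i))/\sum_{Q\in\mathcal P}\exp(\sum_{i\in Q}\theta(i))$. FairMaxEntropy with target $\pi$ is stochastic gradient descent on the convex function $$d(\theta)=\log\Big(\sum_{P\in\mathcal P}\exp\Big(\sum_{i\in P}\theta(i)\Big)\Big)-\langle\theta,\pi\rangle,\qquad \theta\in\mathbb R^N,$$ whose gradient at $\theta$ is $\pi_{\lambda_{e^\theta}}-\pi$. It starts at $\theta_1=0$. At iteration $t$, a fixed number $s\ge1$ of panels is drawn independently from $\lambda_{e^{\theta_t}}$ (exact sampling is assumed, with fresh randomness in each iteration), $\overline\pi_t(i)$ is the fraction of the drawn panels that contain $i$, and $\theta_{t+1}=\theta_t-\gamma_t(\overline\pi_t-\pi)$. The step sizes follow the last-iterate schedule of Jain, Nagaraj and Netrapalli for horizon $T$: let $l=\min\{i\ge0: T2^{-i}\le1\}$, $T_i=T-\lceil T2^{-i}\rceil$ for $0\le i\le l$, $T_{l+1}=T$, and $\gamma_t=C\,2^{-i}/\sqrt T$ whenever $T_i<t\le T_{i+1}$, where $C>0$ is a constant independent of $T$. The last iterate is $\theta_T$, and the distribution obtained from it is $\lambda=\lambda_{e^{\theta_T}}$. *)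

theory Defs
  imports "HOL-Probability.Probability"
begin

text \<open>
  The pool \<open>N\<close> is the finite index type \<open>'n\<close>, so vectors in \<open>\<real>\<^sup>N\<close> are of type \<open>real ^ 'n\<close>.
  Features are functions into a common value type; \<open>V f\<close> is the finite codomain of \<open>f\<close>.
  Probability distributions on panels are probability mass functions on sets of pool members
  whose support consists of panels.
\<close>

definition sortition_instance ::
  "('n::finite \<Rightarrow> 'v) set \<Rightarrow> (('n \<Rightarrow> 'v) \<Rightarrow> 'v set) \<Rightarrow> nat \<Rightarrow>
   (('n \<Rightarrow> 'v) \<Rightarrow> 'v \<Rightarrow> nat) \<Rightarrow> (('n \<Rightarrow> 'v) \<Rightarrow> 'v \<Rightarrow> nat) \<Rightarrow> bool" where
  "sortition_instance F V k l u \<longleftrightarrow>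
     finite F \<and>
     (\<forall>f\<in>F. finite (V f) \<and> range f \<subseteq> V f) \<and>
     (\<forall>f\<in>F. \<forall>v\<in>V f. l f v \<le> u f v \<and> u f v \<le> k)"

definition panels ::
  "('n::finite \<Rightarrow> 'v) set \<Rightarrow> (('n \<Rightarrow> 'v) \<Rightarrow> 'v set) \<Rightarrow> nat \<Rightarrow>
   (('n \<Rightarrow> 'v) \<Rightarrow> 'v \<Rightarrow> nat) \<Rightarrow> (('n \<Rightarrow> 'v) \<Rightarrow> 'v \<Rightarrow> nat) \<Rightarrow> 'n set set" where
  "panels F V k l u =
     {P. card P = k \<and>
         (\<forall>f\<in>F. \<forall>v\<in>V f. l f v \<le> card {i\<in>P. f i = v} \<and> card {i\<in>P. f i = v} \<le> u f v)}"

definition panel_dists :: "'n::finite set set \<Rightarrow> 'n set pmf set" where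
  "panel_dists PS = {\<mu>. set_pmf \<mu> \<subseteq> PS}"

definition selection_probs :: "'n::finite set set \<Rightarrow> 'n set pmf \<Rightarrow> real ^ 'n" where
  "selection_probs PS \<mu> = (\<chi> i. \<Sum>P\<in>{P\<in>PS. i \<in> P}. pmf \<mu> P)"

definition selection_polytope :: "'n::finite set set \<Rightarrow> (real ^ 'n) set" where
  "selection_polytope PS = selection_probs PS ` panel_dists PS"

text \<open>The convention \<open>0 log 0 = 0\<close> is automatic, since multiplication by \<open>0\<close> gives \<open>0\<close>.\<close>

definition shannon_entropy :: "'n::finite set set \<Rightarrow> 'n set pmf \<Rightarrow> real" where
  "shannon_entropy PS \<mu> = - (\<Sum>P\<in>PS. pmf \<mu> P * ln (pmf \<mu> P))"

definition exp_dist :: "'n::finite set set \<Rightarrow> real ^ 'n \<Rightarrow> 'n set pmf" where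
  "exp_dist PS \<theta> = embed_pmf (\<lambda>P.
     if P \<in> PS then exp (\<Sum>i\<in>P. \<theta> $ i) / (\<Sum>Q\<in>PS. exp (\<Sum>i\<in>Q. \<theta> $ i)) else 0)"

lemma pmf_exp_dist:
  fixes PS :: "'n::finite set set"
  assumes "PS \<noteq> {}"
  shows "pmf (exp_dist PS \<theta>) P =
    (if P \<in> PS then exp (\<Sum>i\<in>P. \<theta> $ i) / (\<Sum>Q\<in>PS. exp (\<Sum>i\<in>Q. \<theta> $ i)) else 0)"
proof -
  let ?Z = "\<Sum>Q\<in>PS. exp (\<Sum>i\<in>Q. \<theta> $ i)"
  let ?g = "\<lambda>P. if P \<in> PS then exp (\<Sum>i\<in>P. \<theta> $ i) / ?Z else 0"
  have Z: "?Z > 0" using assms by (intro sum_pos) auto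
  have nn: "?g Q \<ge> 0" for Q using Z by auto
  have "(\<Sum>Q\<in>UNIV. ?g Q) = (\<Sum>Q\<in>PS. exp (\<Sum>i\<in>Q. \<theta> $ i) / ?Z)"
    by (simp add: sum.If_cases)
  also have "\<dots> = 1" using Z by (simp flip: sum_divide_distrib)
  finally have "(\<integral>\<^sup>+ Q. ennreal (?g Q) \<partial>count_space UNIV) = 1"
    by (subst nn_integral_count_space_finite) (simp_all only: finite sum_ennreal nn ennreal_1)
  then show ?thesis
    unfolding exp_dist_def using nn by (subst pmf_embed_pmf) auto
qed

definition empirical_probs :: "'n::finite set list \<Rightarrow> real ^ 'n" where
  "empirical_probs Ps = (\<chi> i. real (card {j. j < length Ps \<and> i \<in> Ps ! j}) / real (length Ps))"

text \<open>
  \<open>fme_iterate PS \<pi> s \<gamma> t\<close> is the law of the \<open>t\<close>-th iterate \<open>\<theta>\<^sub>t\<close> of FairMaxEntropy, for \<open>t \<ge> 1\<close>;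
  indices start at \<open>1\<close> and the value at \<open>0\<close> is a dummy.
  \<open>replicate_pmf s p\<close> is the law of a list of \<open>s\<close> independent samples from \<open>p\<close>.
  The update is a stochastic gradient step for
  \<open>d \<theta> = ln (\<Sum>P\<in>PS. exp (\<Sum>i\<in>P. \<theta> $ i)) - \<theta> \<bullet> \<pi>\<close>, whose gradient at \<open>\<theta>\<close> is
  \<open>selection_probs PS (exp_dist PS \<theta>) - \<pi>\<close>.
\<close>

primrec fme_iterate ::
  "'n::finite set set \<Rightarrow> real ^ 'n \<Rightarrow> nat \<Rightarrow> (nat \<Rightarrow> real) \<Rightarrow> nat \<Rightarrow> (real ^ 'n) pmf" where
  "fme_iterate PS \<pi> s \<gamma> 0 = return_pmf 0"
| "fme_iterate PS \<pi> s \<gamma> (Suc t) =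
     (if t = 0 then return_pmf 0
      else bind_pmf (fme_iterate PS \<pi> s \<gamma> t) (\<lambda>\<theta>.
             map_pmf (\<lambda>Ps. \<theta> - \<gamma> t *\<^sub>R (empirical_probs Ps - \<pi>))
               (replicate_pmf s (exp_dist PS \<theta>))))"

lemma finite_set_pmf_fme_iterate: "finite (set_pmf (fme_iterate PS \<pi> s \<gamma> t))"
proof (induction t)
  case (Suc t)
  have "finite (set_pmf (replicate_pmf s (exp_dist PS \<theta>)))" for \<theta>
    by (rule finite_subset[OF _ finite_lists_length_eq[of UNIV s]])
       (auto simp: set_replicate_pmf)
  with Suc show ?case by auto
qed auto

text \<open>
  The last-iterate step sizes of Jain, Nagaraj and Netrapalli for horizon \<open>T\<close>:
  \<open>jnn_phases T\<close> is \<open>l\<close>, \<open>jnn_time T i\<close> is \<open>T\<^sub>i\<close>, and \<open>jnn_phase T t\<close> is the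
  \<open>i\<close> with \<open>T\<^sub>i < t \<le> T\<^sub>i\<^sub>+\<^sub>1\<close>, which exists and is unique for \<open>1 \<le> t \<le> T\<close> (see below).
\<close>

definition jnn_phases :: "nat \<Rightarrow> nat" where
  "jnn_phases T = (LEAST i. real T / 2 ^ i \<le> 1)"

definition jnn_time :: "nat \<Rightarrow> nat \<Rightarrow> nat" where
  "jnn_time T i = (if i \<le> jnn_phases T then T - nat \<lceil>real T / 2 ^ i\<rceil> else T)"

definition jnn_phase :: "nat \<Rightarrow> nat \<Rightarrow> nat" where
  "jnn_phase T t = (THE i. i \<le> jnn_phases T \<and> jnn_time T i < t \<and> t \<le> jnn_time T (Suc i))"

definition jnn_step :: "real \<Rightarrow> nat \<Rightarrow> nat \<Rightarrow> real" where
  "jnn_step C T t = C / 2 ^ jnn_phase T t / sqrt (real T)"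

lemma jnn_time_mono: "i \<le> j \<Longrightarrow> jnn_time T i \<le> jnn_time T j"
  unfolding jnn_time_def
  by (auto intro!: diff_le_mono2 nat_mono ceiling_mono divide_left_mono power_increasing)

lemma jnn_phase_unique:
  assumes "1 \<le> t" "t \<le> T"
  shows "\<exists>!i. i \<le> jnn_phases T \<and> jnn_time T i < t \<and> t \<le> jnn_time T (Suc i)"
proof -
  have T0: "jnn_time T 0 = 0" by (simp add: jnn_time_def)
  have Tl: "jnn_time T (Suc (jnn_phases T)) = T" by (simp add: jnn_time_def)
  define m where "m = (LEAST j. t \<le> jnn_time T j)"
  have m1: "t \<le> jnn_time T m" unfolding m_def by (rule LeastI[of _ "Suc (jnn_phases T)"]) (use Tl assms in simp)
  have m2: "m \<le> Suc (jnn_phases T)" unfolding m_def by (rule Least_le) (use Tl assms in simp)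
  have "m \<noteq> 0" using m1 T0 assms by (cases m) auto
  then obtain i where i: "m = Suc i" by (cases m) auto
  have "\<not> t \<le> jnn_time T i" using not_less_Least[of i "\<lambda>j. t \<le> jnn_time T j"] i m_def by auto
  show ?thesis
  proof (rule ex1I[of _ i])
    show "i \<le> jnn_phases T \<and> jnn_time T i < t \<and> t \<le> jnn_time T (Suc i)"
      using m1 m2 i \<open>\<not> t \<le> jnn_time T i\<close> by auto
  next
    fix j assume j: "j \<le> jnn_phases T \<and> jnn_time T j < t \<and> t \<le> jnn_time T (Suc j)"
    show "j = i"
    proof (rule ccontr)
      assume "j \<noteq> i"
      then consider "Suc j \<le> i" | "Suc i \<le> j" by linarith
      then show False
        using jnn_time_mono[of "Suc j" i T] jnn_time_mono[of "Suc i" j T] j m1 i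
          \<open>\<not> t \<le> jnn_time T i\<close> by cases auto
    qed
  qed
qed

end

theory Submission
  imports Defs
begin

text \<open>
  The distribution \<open>exp_dist PS \<theta>\<close> maximises entropy for its own selection probabilities by Gibbs'
  inequality, since \<open>ln (pmf (exp_dist PS \<theta>) P)\<close> is affine in the indicator vector of \<open>P\<close>.

  For the rate, the dual objective \<open>d\<close> is convex and, by Hoeffding's lemma, smooth, so that
  \<open>\<parallel>\<nabla>d \<theta>\<parallel>\<^sup>2\<close> is at most a constant times \<open>d \<theta> - min d\<close>. The minimum is attained because \<open>\<pi>\<close> lies
  in the relative interior: \<open>d\<close> is coercive on the directions of the polytope and constant along
  their orthogonal complement. It remains to bound \<open>d\<close> at the last iterate, where only the usual
  stochastic gradient regret bounds are needed, with comparison point either the minimiser or an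
  earlier iterate.
\<close>

subsection \<open>The dual objective\<close>

definition log_partition :: "'n::finite set set \<Rightarrow> real ^ 'n \<Rightarrow> real" where
  "log_partition PS \<theta> = ln (\<Sum>Q\<in>PS. exp (\<Sum>i\<in>Q. \<theta> $ i))"

definition dual_objective :: "'n::finite set set \<Rightarrow> real ^ 'n \<Rightarrow> real ^ 'n \<Rightarrow> real" where
  "dual_objective PS \<pi> \<theta> = log_partition PS \<theta> - \<theta> \<bullet> \<pi>"

lemma sum_pmf_panel_dists:
  fixes PS :: "'n::finite set set"
  assumes "\<mu> \<in> panel_dists PS"
  shows "(\<Sum>P\<in>PS. pmf \<mu> P) = 1"
  using assms by (intro sum_pmf_eq_1) (auto simp: panel_dists_def)

lemma exp_dist_in_panel_dists:
  fixes PS :: "'n::finite set set"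
  assumes "PS \<noteq> {}"
  shows "exp_dist PS \<theta> \<in> panel_dists PS"
  using assms by (auto simp: panel_dists_def set_pmf_eq pmf_exp_dist split: if_splits)

lemma inner_selection_probs:
  fixes PS :: "'n::finite set set"
  shows "x \<bullet> selection_probs PS \<mu> = (\<Sum>P\<in>PS. pmf \<mu> P * (\<Sum>i\<in>P. x $ i))"
proof -
  have "x \<bullet> selection_probs PS \<mu> = (\<Sum>i\<in>UNIV. \<Sum>P\<in>{P\<in>PS. i \<in> P}. pmf \<mu> P * x $ i)"
    by (simp add: selection_probs_def inner_vec_def sum_distrib_left mult.commute)
  also have "\<dots> = (\<Sum>i\<in>UNIV. \<Sum>P\<in>PS. if i \<in> P then pmf \<mu> P * x $ i else 0)"
    by (simp add: sum.If_cases Int_def)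
  also have "\<dots> = (\<Sum>P\<in>PS. \<Sum>i\<in>UNIV. if i \<in> P then pmf \<mu> P * x $ i else 0)"
    by (rule sum.swap)
  also have "\<dots> = (\<Sum>P\<in>PS. pmf \<mu> P * (\<Sum>i\<in>P. x $ i))"
    by (simp add: sum.If_cases sum_distrib_left)
  finally show ?thesis .
qed

section \<open>Entropy and exponential weights\<close>

lemma ln_pmf_exp_dist:
  fixes PS :: "'n::finite set set"
  assumes "P \<in> PS"
  shows "ln (pmf (exp_dist PS \<theta>) P) = (\<Sum>i\<in>P. \<theta> $ i) - log_partition PS \<theta>"
proof -
  have "PS \<noteq> {}" using assms by auto
  moreover have "(\<Sum>Q\<in>PS. exp (\<Sum>i\<in>Q. \<theta> $ i)) > 0"
    using assms by (intro sum_pos) auto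
  ultimately show ?thesis
    using assms by (simp add: pmf_exp_dist log_partition_def ln_div)
qed

text \<open>Nonnegativity of the relative entropy of \<mu> with respect to
  \<open>exp_dist PS \<theta>\<close>. The log-weights of the latter are affine in the panel, so the
  cross term depends on \<mu> only through its selection probabilities.\<close>

lemma gibbs_inequality:
  fixes PS :: "'n::finite set set"
  assumes "PS \<noteq> {}" and \<mu>: "\<mu> \<in> panel_dists PS"
  shows "shannon_entropy PS \<mu> \<le> log_partition PS \<theta> - \<theta> \<bullet> selection_probs PS \<mu>"
proof -
  let ?q = "exp_dist PS \<theta>"
  have "(\<Sum>P\<in>PS. pmf \<mu> P * (ln (pmf ?q P) - ln (pmf \<mu> P))) \<le> (\<Sum>P\<in>PS. pmf ?q P - pmf \<mu> P)"
  proof (rule sum_mono)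
    fix P assume P: "P \<in> PS"
    have q: "pmf ?q P > 0"
      using P assms by (auto simp: pmf_exp_dist intro!: divide_pos_pos sum_pos)
    show "pmf \<mu> P * (ln (pmf ?q P) - ln (pmf \<mu> P)) \<le> pmf ?q P - pmf \<mu> P"
    \<comment> \<open>Where \<mu> has mass, this is \<open>ln y \<le> y - 1\<close> at the ratio of
      the two masses; where it has none, the left side is 0.\<close>
    proof (cases "pmf \<mu> P = 0")
      case False
      then have m: "pmf \<mu> P > 0" by (simp add: pmf_pos)
      have "ln (pmf ?q P / pmf \<mu> P) \<le> pmf ?q P / pmf \<mu> P - 1"
        using q m by (intro ln_le_minus_one) simp
      then have "pmf \<mu> P * ln (pmf ?q P / pmf \<mu> P) \<le> pmf \<mu> P * (pmf ?q P / pmf \<mu> P - 1)"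
        using m by (intro mult_left_mono) auto
      then show ?thesis using q m by (simp add: ln_div right_diff_distrib)
    qed (use q in simp)
  qed
  also have "\<dots> = 0"
    using sum_pmf_panel_dists[OF \<mu>] sum_pmf_panel_dists[OF exp_dist_in_panel_dists, of PS \<theta>] assms
    by (simp add: sum_subtractf)
  finally have *: "(\<Sum>P\<in>PS. pmf \<mu> P * (ln (pmf ?q P) - ln (pmf \<mu> P))) \<le> 0" .
  have "(\<Sum>P\<in>PS. pmf \<mu> P * (ln (pmf ?q P) - ln (pmf \<mu> P))) =
      (\<Sum>P\<in>PS. pmf \<mu> P * (\<Sum>i\<in>P. \<theta> $ i) - log_partition PS \<theta> * pmf \<mu> P - pmf \<mu> P * ln (pmf \<mu> P))"
    by (intro sum.cong refl) (simp add: ln_pmf_exp_dist algebra_simps)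
  also have "\<dots> = \<theta> \<bullet> selection_probs PS \<mu> - log_partition PS \<theta> + shannon_entropy PS \<mu>"
    using sum_pmf_panel_dists[OF \<mu>]
    by (simp add: sum_subtractf inner_selection_probs shannon_entropy_def flip: sum_distrib_left)
  finally show ?thesis using * by simp
qed

lemma shannon_entropy_exp_dist:
  fixes PS :: "'n::finite set set"
  assumes "PS \<noteq> {}"
  shows "shannon_entropy PS (exp_dist PS \<theta>) =
    log_partition PS \<theta> - \<theta> \<bullet> selection_probs PS (exp_dist PS \<theta>)"
proof -
  let ?q = "exp_dist PS \<theta>"
  have "shannon_entropy PS ?q =
      - (\<Sum>P\<in>PS. pmf ?q P * (\<Sum>i\<in>P. \<theta> $ i) - log_partition PS \<theta> * pmf ?q P)"
    unfolding shannon_entropy_def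
    by (intro arg_cong[where f = uminus] sum.cong refl) (simp add: ln_pmf_exp_dist algebra_simps)
  then show ?thesis
    using sum_pmf_panel_dists[OF exp_dist_in_panel_dists[OF assms], of \<theta>]
    by (simp add: sum_subtractf inner_selection_probs flip: sum_distrib_left)
qed

lemma exp_dist_max_entropy:
  fixes PS :: "'n::finite set set"
  assumes "PS \<noteq> {}"
  shows "is_arg_max (shannon_entropy PS)
    (\<lambda>\<mu>. \<mu> \<in> panel_dists PS \<and> selection_probs PS \<mu> = selection_probs PS (exp_dist PS \<theta>))
    (exp_dist PS \<theta>)"
proof -
  have "shannon_entropy PS \<mu> \<le> shannon_entropy PS (exp_dist PS \<theta>)"
    if "\<mu> \<in> panel_dists PS" "selection_probs PS \<mu> = selection_probs PS (exp_dist PS \<theta>)" for \<mu>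
    using gibbs_inequality[OF assms that(1), of \<theta>] that(2) shannon_entropy_exp_dist[OF assms, of \<theta>]
    by simp
  then show ?thesis
    by (auto simp: is_arg_max_def exp_dist_in_panel_dists[OF assms] simp flip: not_le)
qed

text \<open>Exponential tilting: the increment of the log-partition function is the cumulant
  generating function of the panel weight under \<open>exp_dist PS \<theta>\<close>. Convexity and
  smoothness become a lower and an upper bound on it.\<close>

lemma log_partition_add:
  fixes PS :: "'n::finite set set"
  assumes "PS \<noteq> {}"
  shows "log_partition PS (\<theta> + x) =
    log_partition PS \<theta> + ln (\<Sum>P\<in>PS. pmf (exp_dist PS \<theta>) P * exp (\<Sum>i\<in>P. x $ i))"
proof -
  let ?Z = "\<Sum>Q\<in>PS. exp (\<Sum>i\<in>Q. \<theta> $ i)"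
  have Z: "?Z > 0" using assms by (intro sum_pos) auto
  have "(\<Sum>P\<in>PS. pmf (exp_dist PS \<theta>) P * exp (\<Sum>i\<in>P. x $ i)) =
      (\<Sum>P\<in>PS. exp (\<Sum>i\<in>P. (\<theta> + x) $ i)) / ?Z"
    unfolding sum_divide_distrib using assms
    by (intro sum.cong refl) (simp add: pmf_exp_dist sum.distrib exp_add)
  moreover have "(\<Sum>P\<in>PS. exp (\<Sum>i\<in>P. (\<theta> + x) $ i)) > 0"
    using assms by (intro sum_pos) auto
  ultimately show ?thesis using Z by (simp add: log_partition_def ln_div)
qed

text \<open>Jensen's inequality for the tilted expectation, in the form of the first-order condition
  at \<theta>. It avoids differentiating the dual objective.\<close>

lemma dual_objective_convex:
  fixes PS :: "'n::finite set set"
  assumes "PS \<noteq> {}"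
  shows "dual_objective PS \<pi> \<theta> + (x - \<theta>) \<bullet> (selection_probs PS (exp_dist PS \<theta>) - \<pi>)
    \<le> dual_objective PS \<pi> x"
proof -
  let ?q = "exp_dist PS \<theta>" and ?y = "\<lambda>P. \<Sum>i\<in>P. (x - \<theta>) $ i"
  define m where "m = (x - \<theta>) \<bullet> selection_probs PS ?q"
  note q = sum_pmf_panel_dists[OF exp_dist_in_panel_dists[OF assms], of \<theta>]
  \<comment> \<open>Centring at the mean \<open>m\<close> lets \<open>1 + z \<le> exp z\<close>
    yield Jensen's inequality for \<open>exp\<close>.\<close>
  have "1 = (\<Sum>P\<in>PS. pmf ?q P * (1 + (?y P - m)))"
    using q by (simp add: m_def inner_selection_probs algebra_simps sum.distrib sum_subtractf
        flip: sum_distrib_left sum_distrib_right)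
  also have "\<dots> \<le> (\<Sum>P\<in>PS. pmf ?q P * exp (?y P - m))"
    by (intro sum_mono mult_left_mono exp_ge_add_one_self) auto
  also have "\<dots> = (\<Sum>P\<in>PS. pmf ?q P * exp (?y P)) / exp m"
    by (simp add: exp_diff sum_divide_distrib)
  finally have "exp m \<le> (\<Sum>P\<in>PS. pmf ?q P * exp (?y P))" by (simp add: field_simps)
  then have "m \<le> ln (\<Sum>P\<in>PS. pmf ?q P * exp (?y P))"
    by (metis exp_gt_zero ln_exp ln_mono)
  then show ?thesis
    using log_partition_add[OF assms, of \<theta> "x - \<theta>"]
    by (simp add: dual_objective_def m_def algebra_simps)
qed

text \<open>Hoeffding's lemma turns the boundedness of the panel weights into smoothness.\<close>

lemma ln_expectation_exp_le:
  fixes PS :: "'n::finite set set"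
  assumes \<mu>: "\<mu> \<in> panel_dists PS" and b: "\<And>P. P \<in> PS \<Longrightarrow> \<bar>y P\<bar> \<le> b"
  shows "ln (\<Sum>P\<in>PS. pmf \<mu> P * exp (y P)) \<le> (\<Sum>P\<in>PS. pmf \<mu> P * y P) + b\<^sup>2 / 2"
proof -
  have sub: "set_pmf \<mu> \<subseteq> PS" using \<mu> by (simp add: panel_dists_def)
  have E: "measure_pmf.expectation \<mu> h = (\<Sum>P\<in>PS. pmf \<mu> P * h P)" for h :: "_ \<Rightarrow> real"
    by (subst integral_measure_pmf[of PS]) (use sub in auto)
  define m where "m = (\<Sum>P\<in>PS. pmf \<mu> P * y P)"
  note [simp] = integrable_measure_pmf_finite[of \<mu>]
  interpret interval_bounded_random_variable "measure_pmf \<mu>" "\<lambda>P. y P - m" "- b - m" "b - m"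
  proof unfold_locales
    show "AE P in \<mu>. y P - m \<in> {- b - m..b - m}"
      using b sub by (force simp: AE_measure_pmf_iff)
  qed auto
  have "measure_pmf.expectation \<mu> (\<lambda>P. y P - m) = 0"
    using sum_pmf_panel_dists[OF \<mu>] unfolding E m_def
    by (simp add: algebra_simps sum_subtractf flip: sum_distrib_left sum_distrib_right)
  \<comment> \<open>The centred variable lies in an interval of length \<open>2 * b\<close>, so
    Hoeffding's exponent is \<open>(2 * b)\<^sup>2 / 8 = b\<^sup>2 / 2\<close>.\<close>
  from Hoeffdings_lemma_nn_integral_0[OF zero_less_one this]
  have "nn_integral \<mu> (\<lambda>P. exp (y P - m)) \<le> ennreal (exp (b\<^sup>2 / 2))"
    by (simp add: power2_eq_square algebra_simps)
  then have "measure_pmf.expectation \<mu> (\<lambda>P. exp (y P - m)) \<le> exp (b\<^sup>2 / 2)"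
    by (subst (asm) nn_integral_eq_integral) auto
  then have "(\<Sum>P\<in>PS. pmf \<mu> P * exp (y P)) / exp m \<le> exp (b\<^sup>2 / 2)"
    unfolding E by (simp add: exp_diff sum_divide_distrib)
  then have le: "(\<Sum>P\<in>PS. pmf \<mu> P * exp (y P)) \<le> exp (m + b\<^sup>2 / 2)"
    by (simp add: pos_divide_le_eq exp_add mult.commute)
  have "0 < (\<Sum>P\<in>PS. pmf \<mu> P * exp (y P))"
  proof -
    obtain P where "P \<in> set_pmf \<mu>" using set_pmf_not_empty by fast
    then show ?thesis using sub by (intro sum_pos2[of _ P]) (auto simp: pmf_pos set_pmf_iff)
  qed
  then show ?thesis using le unfolding m_def[symmetric] by (metis ln_exp ln_mono)
qed

lemma dual_objective_smooth:
  fixes PS :: "'n::finite set set"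
  assumes "PS \<noteq> {}"
  shows "dual_objective PS \<pi> (\<theta> + x) \<le> dual_objective PS \<pi> \<theta>
    + x \<bullet> (selection_probs PS (exp_dist PS \<theta>) - \<pi>) + (real CARD('n) * norm x)\<^sup>2 / 2"
proof -
  have b: "\<bar>\<Sum>i\<in>P. x $ i\<bar> \<le> real CARD('n) * norm x" for P :: "'n set"
  proof -
    have "\<bar>\<Sum>i\<in>P. x $ i\<bar> \<le> (\<Sum>i\<in>P. \<bar>x $ i\<bar>)" by (rule sum_abs)
    also have "\<dots> \<le> (\<Sum>i\<in>UNIV. \<bar>x $ i\<bar>)" by (intro sum_mono2) auto
    also have "\<dots> \<le> (\<Sum>i\<in>(UNIV :: 'n set). norm x)" by (intro sum_mono component_le_norm_cart)
    finally show ?thesis by simp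
  qed
  show ?thesis
    using ln_expectation_exp_le[OF exp_dist_in_panel_dists[OF assms], where y = "\<lambda>P. \<Sum>i\<in>P. x $ i", OF b]
    by (simp add: dual_objective_def log_partition_add[OF assms] inner_selection_probs algebra_simps)
qed

text \<open>A gradient step cannot go below the minimum, yet smoothness guarantees a decrease
  proportional to the squared gradient norm.\<close>

lemma norm_gradient_le:
  fixes PS :: "'n::finite set set"
  assumes "PS \<noteq> {}" and min: "\<And>\<theta>. dual_objective PS \<pi> x \<le> dual_objective PS \<pi> \<theta>"
  shows "(norm (selection_probs PS (exp_dist PS \<theta>) - \<pi>))\<^sup>2
    \<le> 2 * (real CARD('n))\<^sup>2 * (dual_objective PS \<pi> \<theta> - dual_objective PS \<pi> x)"
proof -
  define n where "n = real CARD('n)"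
  have n: "n > 0" by (simp add: n_def)
  define g where "g = selection_probs PS (exp_dist PS \<theta>) - \<pi>"
  \<comment> \<open>The step size \<open>1 / n\<^sup>2\<close> is the inverse of the smoothness
    constant and minimises the quadratic upper bound along \<open>g\<close>.\<close>
  have "dual_objective PS \<pi> x \<le> dual_objective PS \<pi> (\<theta> + (- (1 / n\<^sup>2)) *\<^sub>R g)" by (rule min)
  also have "\<dots> \<le> dual_objective PS \<pi> \<theta> + ((- (1 / n\<^sup>2)) *\<^sub>R g) \<bullet> g
      + (n * norm ((- (1 / n\<^sup>2)) *\<^sub>R g))\<^sup>2 / 2"
    unfolding g_def n_def by (rule dual_objective_smooth[OF assms(1)])
  also have "\<dots> = dual_objective PS \<pi> \<theta> - (norm g)\<^sup>2 / (2 * n\<^sup>2)"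
    using n by (simp add: dot_square_norm power_mult_distrib power_divide field_simps power2_eq_square)
  finally show ?thesis using n by (simp add: g_def[symmetric] n_def[symmetric] field_simps)
qed

section \<open>Existence of a minimiser of the dual objective\<close>

lemma inner_le_log_partition:
  fixes PS :: "'n::finite set set"
  assumes "m \<in> selection_polytope PS"
  shows "\<theta> \<bullet> m \<le> log_partition PS \<theta>"
proof -
  obtain \<mu> where \<mu>: "\<mu> \<in> panel_dists PS" and m: "m = selection_probs PS \<mu>"
    using assms by (auto simp: selection_polytope_def)
  have "\<theta> \<bullet> m = (\<Sum>P\<in>PS. pmf \<mu> P * (\<Sum>i\<in>P. \<theta> $ i))" by (simp add: m inner_selection_probs)
  \<comment> \<open>Log-sum-exp dominates every single panel weight, hence also their
    average.\<close>
  also have "\<dots> \<le> (\<Sum>P\<in>PS. pmf \<mu> P * log_partition PS \<theta>)"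
  proof (intro sum_mono mult_left_mono)
    fix P assume P: "P \<in> PS"
    have "exp (\<Sum>i\<in>P. \<theta> $ i) \<le> (\<Sum>Q\<in>PS. exp (\<Sum>i\<in>Q. \<theta> $ i))"
      using P by (intro member_le_sum) auto
    then show "(\<Sum>i\<in>P. \<theta> $ i) \<le> log_partition PS \<theta>"
      unfolding log_partition_def by (metis exp_gt_zero ln_exp ln_mono)
  qed auto
  also have "\<dots> = log_partition PS \<theta>"
    using sum_pmf_panel_dists[OF \<mu>] by (simp flip: sum_distrib_right)
  finally show ?thesis .
qed

text \<open>The witness is the indicator vector of \<open>P\<close>, obtained from the point mass on
  \<open>P\<close>. A functional constant on the polytope is therefore constant on panel
  weights.\<close>

lemma panel_weight_eq_inner:
  fixes PS :: "'n::finite set set"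
  assumes "P \<in> PS"
  shows "\<exists>m\<in>selection_polytope PS. \<forall>x. (\<Sum>i\<in>P. x $ i) = x \<bullet> m"
proof (rule bexI)
  show "selection_probs PS (return_pmf P) \<in> selection_polytope PS"
    using assms by (auto simp: selection_polytope_def panel_dists_def)
  show "\<forall>x. (\<Sum>i\<in>P. x $ i) = x \<bullet> selection_probs PS (return_pmf P)"
    using assms by (auto simp: inner_selection_probs pmf_return indicator_def if_distrib[of "\<lambda>a. a * _"]
        sum.delta cong: if_cong)
qed

lemma dual_objective_attains_min:
  fixes PS :: "'n::finite set set"
  assumes ne: "PS \<noteq> {}" and target: "\<pi> \<in> rel_interior (selection_polytope PS)"
  shows "\<exists>x. \<forall>\<theta>. dual_objective PS \<pi> x \<le> dual_objective PS \<pi> \<theta>"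
proof -
  let ?M = "selection_polytope PS" and ?F = "dual_objective PS \<pi>"
  define D where "D = {m - \<pi> | m. m \<in> ?M - {\<pi>}}"
  obtain e where pi: "\<pi> \<in> ?M" and e: "e > 0" "ball \<pi> e \<inter> affine hull ?M \<subseteq> ?M"
    using target by (auto simp: mem_rel_interior_ball)
  have hull: "affine hull ?M = {\<pi> + v | v. v \<in> span D}"
    unfolding D_def by (rule affine_hull_span[OF pi])
  \<comment> \<open>Moving \<pi> by length \<open>e / 2\<close> in the direction of \<open>w\<close>
    stays inside the polytope, by relative interiority. The linear functional \<open>w\<close> gains
    \<open>e / 2 * norm w\<close> there and is still bounded by the log-partition function.\<close>
  have coercive: "e / 2 * norm w \<le> ?F w" if w: "w \<in> span D" for w
  proof (cases "w = 0")
    case True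
    then show ?thesis using inner_le_log_partition[OF pi, of w] by (simp add: dual_objective_def)
  next
    case False
    define v where "v = (e / (2 * norm w)) *\<^sub>R w"
    have "v \<in> span D" using w by (simp add: v_def span_scale)
    moreover have "norm v < e" using False e by (simp add: v_def)
    ultimately have "\<pi> + v \<in> ?M" using e(2) by (auto simp: hull dist_norm)
    then have "w \<bullet> (\<pi> + v) \<le> log_partition PS w" by (rule inner_le_log_partition)
    moreover have "w \<bullet> v = e / 2 * norm w"
      using False by (simp add: v_def dot_square_norm power2_eq_square)
    ultimately show ?thesis by (simp add: dual_objective_def inner_add_right)
  qed
  \<comment> \<open>Such a \<open>z\<close> gives every panel the weight
    \<open>z \<bullet> \<pi>\<close>, so the log-partition function shifts by exactly the amount
    that the linear term subtracts.\<close>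
  have invariant: "?F (w + z) = ?F w" if z: "\<And>v. v \<in> span D \<Longrightarrow> orthogonal z v" for w z
  proof -
    have const: "z \<bullet> m = z \<bullet> \<pi>" if "m \<in> ?M" for m
    proof (cases "m = \<pi>")
      case False
      then have "m - \<pi> \<in> span D" using that by (intro span_base) (auto simp: D_def)
      from z[OF this] show ?thesis by (simp add: orthogonal_def inner_diff_right)
    qed simp
    have "(\<Sum>i\<in>P. z $ i) = z \<bullet> \<pi>" if "P \<in> PS" for P
      using panel_weight_eq_inner[OF that] const by auto
    then have "(\<Sum>P\<in>PS. exp (\<Sum>i\<in>P. (w + z) $ i)) =
        (\<Sum>P\<in>PS. exp (\<Sum>i\<in>P. w $ i)) * exp (z \<bullet> \<pi>)"
      by (simp add: sum.distrib exp_add sum_distrib_right)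
    moreover have "(\<Sum>P\<in>PS. exp (\<Sum>i\<in>P. w $ i)) > 0" using ne by (intro sum_pos) auto
    ultimately show ?thesis
      by (simp add: dual_objective_def log_partition_def ln_mult inner_add_left)
  qed
  \<comment> \<open>Beyond this radius coercivity forces values above \<open>?F 0\<close>, so
    minimising over the compact ball in \<open>span D\<close> suffices.\<close>
  define r where "r = 2 * ?F 0 / e"
  have F0: "?F 0 \<ge> 0" using coercive[OF span_zero] by simp
  have "compact (cball 0 r \<inter> span D)" by (intro compact_Int_closed closed_span compact_cball)
  moreover have "0 \<in> cball 0 r \<inter> span D" using F0 e by (simp add: r_def span_zero)
  moreover have "continuous_on (cball 0 r \<inter> span D) ?F"
  proof -
    have "(\<Sum>P\<in>PS. exp (\<Sum>i\<in>P. x $ i)) \<noteq> 0" for x :: "real ^ 'n"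
      using sum_pos[of PS "\<lambda>P. exp (\<Sum>i\<in>P. x $ i)"] ne by auto
    then show ?thesis
      unfolding dual_objective_def log_partition_def by (intro continuous_intros) auto
  qed
  ultimately obtain x where x: "x \<in> cball 0 r \<inter> span D"
      and min: "\<And>y. y \<in> cball 0 r \<inter> span D \<Longrightarrow> ?F x \<le> ?F y"
    using continuous_attains_inf[of "cball 0 r \<inter> span D" ?F] by blast
  have "?F x \<le> ?F \<theta>" for \<theta>
  proof -
    obtain w z where w: "w \<in> span D" and z: "\<And>v. v \<in> span D \<Longrightarrow> orthogonal z v" and \<theta>: "\<theta> = w + z"
      by (rule orthogonal_subspace_decomp_exists[of D \<theta>]) blast
    have "?F x \<le> ?F w"
    proof (cases "w \<in> cball 0 r")
      case False
      then have "?F 0 < e / 2 * norm w" using e by (simp add: r_def field_simps)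
      also have "\<dots> \<le> ?F w" by (rule coercive[OF w])
      finally show ?thesis using min[of 0] \<open>0 \<in> cball 0 r \<inter> span D\<close> by simp
    qed (use min w in auto)
    then show ?thesis using invariant[OF z] by (simp add: \<theta>)
  qed
  then show ?thesis by blast
qed

subsection \<open>Regret of stochastic gradient descent\<close>

lemma expectation_bind_finite:
  fixes h :: "'b \<Rightarrow> real"
  assumes "finite (set_pmf p)" "\<And>x. x \<in> set_pmf p \<Longrightarrow> finite (set_pmf (f x))"
  shows "measure_pmf.expectation (bind_pmf p f) h =
    measure_pmf.expectation p (\<lambda>x. measure_pmf.expectation (f x) h)"
  using assms by (simp add: pmf_expectation_bind[of "set_pmf p"] integral_measure_pmf[of "set_pmf p"])

lemma finite_set_replicate_pmf:
  "finite (set_pmf p) \<Longrightarrow> finite (set_pmf (replicate_pmf s p))"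
  by (induction s) auto

lemma inner_empirical_probs:
  fixes x :: "real ^ 'n::finite"
  shows "x \<bullet> empirical_probs Ps = (\<Sum>P\<leftarrow>Ps. \<Sum>i\<in>P. x $ i) / real (length Ps)"
proof -
  have "(\<Sum>P\<leftarrow>Ps. \<Sum>i\<in>P. x $ i) = (\<Sum>i\<in>UNIV. x $ i * real (length (filter (\<lambda>P. i \<in> P) Ps)))"
  proof (induction Ps)
    case (Cons P Ps)
    have "(\<Sum>i\<in>P. x $ i) = (\<Sum>i\<in>UNIV. if i \<in> P then x $ i else 0)" by (simp add: sum.If_cases)
    with Cons show ?case
      by (simp add: sum.distrib[symmetric]) (intro sum.cong refl, simp add: algebra_simps)
  qed simp
  then show ?thesis
    by (simp add: empirical_probs_def inner_vec_def sum_divide_distrib length_filter_conv_card)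
qed

lemma expectation_sum_list_replicate_pmf:
  fixes h :: "'a \<Rightarrow> real"
  assumes fin: "finite (set_pmf p)"
  shows "measure_pmf.expectation (replicate_pmf s p) (\<lambda>xs. \<Sum>x\<leftarrow>xs. h x) =
    real s * measure_pmf.expectation p h"
proof (induction s)
  case (Suc s)
  note f = finite_set_replicate_pmf[OF fin, of s]
  have "measure_pmf.expectation (replicate_pmf (Suc s) p) (\<lambda>xs. \<Sum>x\<leftarrow>xs. h x) =
      measure_pmf.expectation p (\<lambda>x. measure_pmf.expectation (replicate_pmf s p) (\<lambda>xs. h x + (\<Sum>x\<leftarrow>xs. h x)))"
    using fin f by (simp add: expectation_bind_finite)
  also have "\<dots> = measure_pmf.expectation p (\<lambda>x. h x + real s * measure_pmf.expectation p h)"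
    using f by (simp add: Suc.IH integrable_measure_pmf_finite)
  also have "\<dots> = real (Suc s) * measure_pmf.expectation p h"
    using fin by (simp add: integrable_measure_pmf_finite algebra_simps)
  finally show ?case .
qed simp

text \<open>Unbiasedness of the stochastic gradient, tested against an arbitrary vector so that only
  real expectations occur.\<close>

lemma expectation_inner_empirical_probs:
  fixes PS :: "'n::finite set set"
  assumes \<mu>: "\<mu> \<in> panel_dists PS" and s: "s \<ge> 1"
  shows "measure_pmf.expectation (replicate_pmf s \<mu>) (\<lambda>Ps. x \<bullet> empirical_probs Ps) =
    x \<bullet> selection_probs PS \<mu>"
proof -
  have "measure_pmf.expectation (replicate_pmf s \<mu>) (\<lambda>Ps. x \<bullet> empirical_probs Ps) =
      measure_pmf.expectation (replicate_pmf s \<mu>) (\<lambda>Ps. (\<Sum>P\<leftarrow>Ps. \<Sum>i\<in>P. x $ i) / real s)"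
    by (intro integral_cong_AE) (auto simp: AE_measure_pmf_iff set_replicate_pmf inner_empirical_probs)
  also have "\<dots> = measure_pmf.expectation \<mu> (\<lambda>P. \<Sum>i\<in>P. x $ i)"
    using s by (simp add: expectation_sum_list_replicate_pmf)
  also have "\<dots> = x \<bullet> selection_probs PS \<mu>"
    using \<mu> by (subst integral_measure_pmf[of PS]) (auto simp: inner_selection_probs panel_dists_def)
  finally show ?thesis .
qed

lemma norm_empirical_probs_le: "norm (empirical_probs Ps :: real ^ 'n::finite) \<le> real CARD('n)"
proof -
  have "card {j. j < length Ps \<and> i \<in> Ps ! j} \<le> length Ps" for i
    using card_mono[of "{..<length Ps}" "{j. j < length Ps \<and> i \<in> Ps ! j}"] by auto
  then have "\<bar>empirical_probs Ps $ i\<bar> \<le> 1" for i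
    by (simp add: empirical_probs_def divide_le_eq_1)
  then have "(\<Sum>i\<in>(UNIV::'n set). \<bar>empirical_probs Ps $ i\<bar>) \<le> (\<Sum>i\<in>(UNIV::'n set). 1)"
    by (intro sum_mono)
  then show ?thesis using norm_le_l1_cart[of "empirical_probs Ps"] by simp
qed

definition fme_step ::
  "'n::finite set set \<Rightarrow> real ^ 'n \<Rightarrow> nat \<Rightarrow> real \<Rightarrow> real ^ 'n \<Rightarrow> (real ^ 'n) pmf" where
  "fme_step PS \<pi> s c \<theta> =
     map_pmf (\<lambda>Ps. \<theta> - c *\<^sub>R (empirical_probs Ps - \<pi>)) (replicate_pmf s (exp_dist PS \<theta>))"

lemma finite_set_fme_step: "finite (set_pmf (fme_step PS \<pi> s c \<theta>))"
  by (simp add: fme_step_def finite_set_replicate_pmf)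

text \<open>After expanding the square, unbiasedness turns the cross term into the true gradient and
  convexity turns that into the objective gap. The quadratic term is bounded uniformly because
  empirical frequencies lie in [0,1].\<close>

lemma fme_step_distance:
  fixes PS :: "'n::finite set set"
  assumes ne: "PS \<noteq> {}" and s: "s \<ge> 1" and c: "c \<ge> 0"
  shows "measure_pmf.expectation (fme_step PS \<pi> s c \<theta>) (\<lambda>y. (norm (y - x))\<^sup>2)
    \<le> (norm (\<theta> - x))\<^sup>2 - 2 * c * (dual_objective PS \<pi> \<theta> - dual_objective PS \<pi> x)
        + (real CARD('n) + norm \<pi>)\<^sup>2 * c\<^sup>2"
proof -
  let ?B = "(real CARD('n) + norm \<pi>)\<^sup>2" and ?R = "replicate_pmf s (exp_dist PS \<theta>)"
  have int: "integrable ?R h" for h :: "_ \<Rightarrow> real"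
    by (intro integrable_measure_pmf_finite finite_set_replicate_pmf) simp
  \<comment> \<open>The right side is arranged so that its only random term is linear in
    \<open>empirical_probs Ps\<close>.\<close>
  have step: "(norm (\<theta> - c *\<^sub>R (empirical_probs Ps - \<pi>) - x))\<^sup>2 \<le>
      ((norm (\<theta> - x))\<^sup>2 + 2 * c * ((\<theta> - x) \<bullet> \<pi>) + ?B * c\<^sup>2) - 2 * c * ((\<theta> - x) \<bullet> empirical_probs Ps)"
    for Ps
  proof -
    have "norm (empirical_probs Ps - \<pi>) \<le> real CARD('n) + norm \<pi>"
      using norm_triangle_ineq4[of "empirical_probs Ps" \<pi>] norm_empirical_probs_le[of Ps] by simp
    then have "(norm (empirical_probs Ps - \<pi>))\<^sup>2 \<le> ?B" by (intro power_mono) auto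
    then have B: "c\<^sup>2 * (norm (empirical_probs Ps - \<pi>))\<^sup>2 \<le> ?B * c\<^sup>2"
      by (subst mult.commute, rule mult_right_mono) auto
    have expand: "(norm (y - c *\<^sub>R z))\<^sup>2 = (norm y)\<^sup>2 - 2 * c * (y \<bullet> z) + c\<^sup>2 * (norm z)\<^sup>2"
      for y z :: "real ^ 'n"
      unfolding power2_norm_eq_inner
      by (simp add: inner_diff_left inner_diff_right inner_commute power2_eq_square)
    have "(norm (\<theta> - c *\<^sub>R (empirical_probs Ps - \<pi>) - x))\<^sup>2 =
        (norm ((\<theta> - x) - c *\<^sub>R (empirical_probs Ps - \<pi>)))\<^sup>2"
      by (simp add: algebra_simps)
    also have "\<dots> = (norm (\<theta> - x))\<^sup>2 - 2 * c * ((\<theta> - x) \<bullet> (empirical_probs Ps - \<pi>))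
        + c\<^sup>2 * (norm (empirical_probs Ps - \<pi>))\<^sup>2"
      by (rule expand)
    finally show ?thesis using B by (simp add: inner_diff_right algebra_simps)
  qed
  have "measure_pmf.expectation (fme_step PS \<pi> s c \<theta>) (\<lambda>y. (norm (y - x))\<^sup>2) =
      measure_pmf.expectation ?R (\<lambda>Ps. (norm (\<theta> - c *\<^sub>R (empirical_probs Ps - \<pi>) - x))\<^sup>2)"
    by (simp add: fme_step_def)
  also have "\<dots> \<le> measure_pmf.expectation ?R (\<lambda>Ps.
      ((norm (\<theta> - x))\<^sup>2 + 2 * c * ((\<theta> - x) \<bullet> \<pi>) + ?B * c\<^sup>2) - 2 * c * ((\<theta> - x) \<bullet> empirical_probs Ps))"
    by (intro integral_mono int step)
  also have "\<dots> = (norm (\<theta> - x))\<^sup>2 + 2 * c * ((\<theta> - x) \<bullet> \<pi>) + ?B * c\<^sup>2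
      - 2 * c * ((\<theta> - x) \<bullet> selection_probs PS (exp_dist PS \<theta>))"
    using expectation_inner_empirical_probs[OF exp_dist_in_panel_dists[OF ne] s, of \<theta> "\<theta> - x"]
    by (subst Bochner_Integration.integral_diff) (simp_all add: int)
  also have "\<dots> = (norm (\<theta> - x))\<^sup>2 + ?B * c\<^sup>2
      + 2 * c * ((x - \<theta>) \<bullet> (selection_probs PS (exp_dist PS \<theta>) - \<pi>))"
    by (simp add: algebra_simps)
  also have "\<dots> \<le> (norm (\<theta> - x))\<^sup>2 + ?B * c\<^sup>2
      + 2 * c * (dual_objective PS \<pi> x - dual_objective PS \<pi> \<theta>)"
    using dual_objective_convex[OF ne, of \<pi> \<theta> x] c
    by (intro add_left_mono mult_left_mono) auto
  finally show ?thesis by (simp add: algebra_simps)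
qed

text \<open>The run restarted at time \<open>a\<close> from a deterministic point, that is, the law
  of iterate \<open>a + m\<close> conditioned on iterate \<open>a\<close>. Regret against a random
  earlier iterate becomes regret against a fixed point.\<close>

primrec fme_from ::
  "'n::finite set set \<Rightarrow> real ^ 'n \<Rightarrow> nat \<Rightarrow> (nat \<Rightarrow> real) \<Rightarrow> nat \<Rightarrow> real ^ 'n \<Rightarrow> nat \<Rightarrow> (real ^ 'n) pmf" where
  "fme_from PS \<pi> s \<gamma> a \<theta> 0 = return_pmf \<theta>"
| "fme_from PS \<pi> s \<gamma> a \<theta> (Suc m) =
     bind_pmf (fme_from PS \<pi> s \<gamma> a \<theta> m) (fme_step PS \<pi> s (\<gamma> (a + m)))"

lemma finite_set_fme_from: "finite (set_pmf (fme_from PS \<pi> s \<gamma> a \<theta> m))"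
  by (induction m) (auto simp: finite_set_fme_step)

text \<open>The Markov property. It starts at index 1 because the passage from the dummy index 0
  performs no update.\<close>

lemma fme_iterate_add:
  assumes "a \<ge> 1"
  shows "fme_iterate PS \<pi> s \<gamma> (a + m) =
    bind_pmf (fme_iterate PS \<pi> s \<gamma> a) (\<lambda>\<theta>. fme_from PS \<pi> s \<gamma> a \<theta> m)"
  using assms
  by (induction m) (simp_all add: bind_return_pmf' bind_assoc_pmf fme_step_def[abs_def])

text \<open>Telescoping of the one-step bound. The final squared distance stays on the left as the
  potential that carries the induction; the regret bound then drops it.\<close>

lemma fme_from_potential:
  fixes PS :: "'n::finite set set" and \<pi> :: "real ^ 'n"
  assumes ne: "PS \<noteq> {}" and s: "s \<ge> 1" and \<gamma>: "\<And>t. \<gamma> t \<ge> 0"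
  shows "(\<Sum>j<m. 2 * \<gamma> (a + j) * (measure_pmf.expectation (fme_from PS \<pi> s \<gamma> a \<theta> j) (dual_objective PS \<pi>)
      - dual_objective PS \<pi> x))
    + measure_pmf.expectation (fme_from PS \<pi> s \<gamma> a \<theta> m) (\<lambda>y. (norm (y - x))\<^sup>2)
    \<le> (norm (\<theta> - x))\<^sup>2 + (real CARD('n) + norm \<pi>)\<^sup>2 * (\<Sum>j<m. (\<gamma> (a + j))\<^sup>2)"
proof (induction m)
  case (Suc m)
  let ?B = "(real CARD('n) + norm \<pi>)\<^sup>2" and ?F = "dual_objective PS \<pi>"
  let ?K = "fme_from PS \<pi> s \<gamma> a \<theta> m"
  define c where "c = \<gamma> (a + m)"
  have int: "integrable ?K h" for h :: "_ \<Rightarrow> real"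
    by (intro integrable_measure_pmf_finite finite_set_fme_from)
  have "measure_pmf.expectation (fme_from PS \<pi> s \<gamma> a \<theta> (Suc m)) (\<lambda>y. (norm (y - x))\<^sup>2) =
      measure_pmf.expectation ?K (\<lambda>\<theta>. measure_pmf.expectation (fme_step PS \<pi> s c \<theta>) (\<lambda>y. (norm (y - x))\<^sup>2))"
    by (simp add: c_def expectation_bind_finite finite_set_fme_from finite_set_fme_step)
  also have "\<dots> \<le> measure_pmf.expectation ?K
      (\<lambda>\<theta>. (norm (\<theta> - x))\<^sup>2 - 2 * c * (?F \<theta> - ?F x) + ?B * c\<^sup>2)"
    using \<gamma> by (intro integral_mono int fme_step_distance ne s) (simp add: c_def)
  also have "\<dots> = measure_pmf.expectation ?K (\<lambda>\<theta>. (norm (\<theta> - x))\<^sup>2)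
      - 2 * c * (measure_pmf.expectation ?K ?F - ?F x) + ?B * c\<^sup>2"
    by (simp add: int)
  finally show ?case using Suc.IH by (simp add: c_def[symmetric] algebra_simps)
qed simp

lemma fme_from_regret:
  fixes PS :: "'n::finite set set" and \<pi> :: "real ^ 'n"
  assumes ne: "PS \<noteq> {}" and s: "s \<ge> 1" and \<gamma>: "\<And>t. \<gamma> t \<ge> 0"
  shows "(\<Sum>j<m. 2 * \<gamma> (a + j) * (measure_pmf.expectation (fme_from PS \<pi> s \<gamma> a \<theta> j) (dual_objective PS \<pi>)
      - dual_objective PS \<pi> x))
    \<le> (norm (\<theta> - x))\<^sup>2 + (real CARD('n) + norm \<pi>)\<^sup>2 * (\<Sum>j<m. (\<gamma> (a + j))\<^sup>2)"
proof -
  have "measure_pmf.expectation (fme_from PS \<pi> s \<gamma> a \<theta> m) (\<lambda>y. (norm (y - x))\<^sup>2) \<ge> 0"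
    by simp
  with fme_from_potential[
    where \<gamma> = \<gamma> and a = a and m = m and \<theta> = \<theta> and x = x and \<pi> = \<pi>, OF ne s \<gamma>]
  show ?thesis by linarith
qed

lemma sum_shift_interval:
  fixes f :: "nat \<Rightarrow> real"
  shows "(\<Sum>t=a..b. f t) = (\<Sum>j<Suc b - a. f (a + j))"
  by (rule sum.reindex_bij_witness[of _ "\<lambda>j. a + j" "\<lambda>t. t - a"]) auto

text \<open>Conditioning on iterate \<open>a\<close> and comparing with that iterate itself makes
  the initial distance vanish, leaving only the noise term.\<close>

lemma fme_iterate_regret:
  fixes PS :: "'n::finite set set" and \<pi> :: "real ^ 'n"
  assumes ne: "PS \<noteq> {}" and s: "s \<ge> 1" and \<gamma>: "\<And>t. \<gamma> t \<ge> 0" and a: "a \<ge> 1"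
  defines "e \<equiv> \<lambda>t. measure_pmf.expectation (fme_iterate PS \<pi> s \<gamma> t) (dual_objective PS \<pi>)"
  shows "(\<Sum>t=a..b. 2 * \<gamma> t * (e t - e a)) \<le> (real CARD('n) + norm \<pi>)\<^sup>2 * (\<Sum>t=a..b. (\<gamma> t)\<^sup>2)"
proof -
  define m where "m = Suc b - a"
  let ?F = "dual_objective PS \<pi>" and ?I = "fme_iterate PS \<pi> s \<gamma> a"
  let ?E = "\<lambda>\<theta> j. measure_pmf.expectation (fme_from PS \<pi> s \<gamma> a \<theta> j) ?F"
  have int: "integrable ?I h" for h :: "_ \<Rightarrow> real"
    by (intro integrable_measure_pmf_finite finite_set_pmf_fme_iterate)
  have e: "e (a + j) = measure_pmf.expectation ?I (\<lambda>\<theta>. ?E \<theta> j)" for j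
    unfolding e_def fme_iterate_add[OF a]
    by (simp add: expectation_bind_finite finite_set_pmf_fme_iterate finite_set_fme_from)
  have "(\<Sum>j<m. 2 * \<gamma> (a + j) * (e (a + j) - e a)) =
      measure_pmf.expectation ?I (\<lambda>\<theta>. \<Sum>j<m. 2 * \<gamma> (a + j) * (?E \<theta> j - ?F \<theta>))"
    unfolding e by (simp add: int e_def)
  also have "\<dots> \<le> measure_pmf.expectation ?I
      (\<lambda>\<theta>. (real CARD('n) + norm \<pi>)\<^sup>2 * (\<Sum>j<m. (\<gamma> (a + j))\<^sup>2))"
  proof (intro integral_mono int)
    show "(\<Sum>j<m. 2 * \<gamma> (a + j) * (?E \<theta> j - ?F \<theta>)) \<le>
        (real CARD('n) + norm \<pi>)\<^sup>2 * (\<Sum>j<m. (\<gamma> (a + j))\<^sup>2)" for \<theta>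
      using fme_from_regret[
        where \<gamma> = \<gamma> and \<theta> = \<theta> and x = \<theta>, OF ne s \<gamma>] by simp
  qed
  finally show ?thesis by (simp add: sum_shift_interval m_def)
qed

lemma fme_iterate_regret_start:
  fixes PS :: "'n::finite set set" and \<pi> :: "real ^ 'n"
  assumes ne: "PS \<noteq> {}" and s: "s \<ge> 1" and \<gamma>: "\<And>t. \<gamma> t \<ge> 0"
  defines "e \<equiv> \<lambda>t. measure_pmf.expectation (fme_iterate PS \<pi> s \<gamma> t) (dual_objective PS \<pi>)"
  shows "(\<Sum>t=1..b. 2 * \<gamma> t * (e t - dual_objective PS \<pi> x))
    \<le> (norm x)\<^sup>2 + (real CARD('n) + norm \<pi>)\<^sup>2 * (\<Sum>t=1..b. (\<gamma> t)\<^sup>2)"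
proof -
  have "fme_iterate PS \<pi> s \<gamma> (1 + j) = fme_from PS \<pi> s \<gamma> 1 0 j" for j
    using fme_iterate_add[of 1 PS \<pi> s \<gamma> j] by (simp add: bind_return_pmf)
  then show ?thesis
    using fme_from_regret[where \<gamma> = \<gamma> and a = 1 and \<theta> = 0 and x = x, OF ne s \<gamma>]
    unfolding e_def sum_shift_interval
    by (simp del: One_nat_def plus_1_eq_Suc fme_iterate.simps)
qed

subsection \<open>The last iterate\<close>

text \<open>
  The phase-wise argument of Jain, Nagaraj and Netrapalli: starting the regret bound at the best
  iterate \<open>a\<close> of phase \<open>i\<close> makes the terms of that phase nonnegative, so that some iterate of
  phase \<open>i + 1\<close> is worse than iterate \<open>a\<close> by at most a constant times the step size of phase \<open>i\<close>.
  The step sizes decay geometrically and the last phase consists of the last iterate only.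
\<close>

lemma phased_steps_last_iterate:
  fixes \<tau> :: "nat \<Rightarrow> nat" and \<gamma> e :: "nat \<Rightarrow> real" and B D c v :: real
  assumes \<tau>0: "\<tau> 0 = 0"
    and phase: "\<And>i. i \<le> L \<Longrightarrow> \<tau> i < \<tau> (Suc i)"
    and last: "\<tau> (Suc L) = Suc (\<tau> L)"
    and ratio: "\<And>i. i < L \<Longrightarrow> \<tau> (Suc i) - \<tau> i \<le> 3 * (\<tau> (Suc (Suc i)) - \<tau> (Suc i))"
    and step: "\<And>i t. i \<le> L \<Longrightarrow> \<tau> i < t \<Longrightarrow> t \<le> \<tau> (Suc i) \<Longrightarrow> \<gamma> t = c / 2 ^ i"
    and c: "c > 0" and B: "B \<ge> 0"
    and regret: "\<And>a b. 1 \<le> a \<Longrightarrow>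
      (\<Sum>t=a..b. 2 * \<gamma> t * (e t - e a)) \<le> B * (\<Sum>t=a..b. (\<gamma> t)\<^sup>2)"
    and regret_start: "\<And>b. (\<Sum>t=1..b. 2 * \<gamma> t * (e t - v)) \<le> D + B * (\<Sum>t=1..b. (\<gamma> t)\<^sup>2)"
  shows "e (\<tau> (Suc L)) \<le> v + D / (2 * c * real (\<tau> 1)) + 9 * B * c"
proof -
  \<comment> \<open>This bounds the average value in the first phase, where the step size is
    constantly \<open>c\<close>; hence some iterate there is at most \<open>w\<close>.\<close>
  define w where "w = v + D / (2 * c * real (\<tau> 1)) + B * c / 2"
  \<comment> \<open>Passing from phase \<open>j\<close> to the next costs
    \<open>4 * B * c / 2 ^ j\<close>; summing over \<open>j < i\<close> gives the geometric
    expression.\<close>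
  have "\<exists>t\<in>{\<tau> i<..\<tau> (Suc i)}. e t \<le> w + 8 * B * c * (1 - 1 / 2 ^ i)" if "i \<le> L" for i
    using that
  proof (induction i)
    case 0
    show ?case
    proof (rule ccontr)
      assume "\<not> ?thesis"
      then have big: "w < e t" if "t \<in> {1..\<tau> 1}" for t using that \<tau>0 by (auto simp: not_le)
      have \<tau>1: "\<tau> 1 > 0" using phase[of 0] \<tau>0 by simp
      have \<gamma>: "\<gamma> t = c" if "t \<in> {1..\<tau> 1}" for t using step[of 0 t] \<tau>0 that by simp
      have "D + B * (\<Sum>t=1..\<tau> 1. (\<gamma> t)\<^sup>2) = (\<Sum>t=1..\<tau> 1. 2 * c * (w - v))"
        using \<tau>1 c \<gamma> by (simp add: w_def field_simps power2_eq_square)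
      also have "\<dots> < (\<Sum>t=1..\<tau> 1. 2 * \<gamma> t * (e t - v))"
        using \<tau>1 c big \<gamma> by (intro sum_strict_mono) (auto simp: Suc_le_eq)
      finally show False using regret_start[of "\<tau> 1"] by simp
    qed
  next
    case (Suc i)
    define g where "g = c / 2 ^ i"
    have g: "g > 0" using c by (simp add: g_def)
    let ?p = "\<tau> i" and ?q = "\<tau> (Suc i)" and ?r = "\<tau> (Suc (Suc i))"
    have qr: "?q < ?r" using phase Suc.prems by blast
    have "?p < ?q" using phase Suc.prems by simp
    then obtain a where a: "a \<in> {?p<..?q}" and best: "\<And>t. t \<in> {?p<..?q} \<Longrightarrow> e a \<le> e t"
      using arg_min_if_finite(1)[of "{?p<..?q}" e] arg_min_least[of "{?p<..?q}" _ e]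
      by (metis empty_iff finite_greaterThanAtMost greaterThanAtMost_iff order_refl)
    have ea: "e a \<le> w + 8 * B * c * (1 - 1 / 2 ^ i)" using Suc best by fastforce
    have \<gamma>i: "\<gamma> t = g" if "t \<in> {a..?q}" for t
      using step[of i t] that a Suc.prems by (simp add: g_def)
    have \<gamma>Si: "\<gamma> t = g / 2" if "t \<in> {?q<..?r}" for t
      using step[of "Suc i" t] that Suc.prems by (simp add: g_def)
    have split: "(\<Sum>t=a..?r. f t) = (\<Sum>t=a..?q. f t) + (\<Sum>t\<in>{?q<..?r}. f t)" for f :: "nat \<Rightarrow> real"
      using a qr by (subst sum.union_disjoint[symmetric]) (auto intro!: sum.cong)
    \<comment> \<open>With \<open>n\<close> steps in the new phase there are at most
      \<open>3 * n\<close> earlier ones, so the noise is at most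
      \<open>(3 + 1/4) * n * B * g\<^sup>2\<close>. If all new values exceeded the bound, the regret
      would be more than \<open>4 * n * B * g\<^sup>2\<close>.\<close>
    have "\<exists>t\<in>{?q<..?r}. e t \<le> e a + 4 * B * g"
    proof (rule ccontr)
      assume "\<not> ?thesis"
      then have big: "e a + 4 * B * g < e t" if "t \<in> {?q<..?r}" for t using that by (auto simp: not_le)
      have "card {a..?q} \<le> ?q - ?p" using a by auto
      then have "card {a..?q} \<le> 3 * (?r - ?q)" using ratio[of i] Suc.prems by linarith
      then have "real (card {a..?q}) \<le> 3 * real (?r - ?q)" by linarith
      then have "real (card {a..?q}) * (B * g\<^sup>2) \<le> 3 * real (?r - ?q) * (B * g\<^sup>2)"
        using B by (intro mult_right_mono) auto
      moreover have "0 \<le> real (?r - ?q) * (B * g\<^sup>2)" using B by simp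
      moreover have "(\<Sum>t=a..?q. (\<gamma> t)\<^sup>2) = real (card {a..?q}) * g\<^sup>2" using \<gamma>i by simp
      moreover have "(\<Sum>t\<in>{?q<..?r}. (\<gamma> t)\<^sup>2) = real (?r - ?q) * (g / 2)\<^sup>2" by (simp add: \<gamma>Si)
      moreover have "B * (m * g\<^sup>2 + n * (g / 2)\<^sup>2) = m * (B * g\<^sup>2) + n * (B * g\<^sup>2) / 4" for m n :: real
        by (simp add: power2_eq_square field_simps)
      ultimately have "B * (\<Sum>t=a..?r. (\<gamma> t)\<^sup>2) \<le> 4 * (real (?r - ?q) * (B * g\<^sup>2))"
        unfolding split by simp
      also have "\<dots> = (\<Sum>t\<in>{?q<..?r}. g * (4 * B * g))" by (simp add: power2_eq_square)
      also have "\<dots> < (\<Sum>t\<in>{?q<..?r}. 2 * \<gamma> t * (e t - e a))"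
      proof (intro sum_strict_mono)
        fix t assume t: "t \<in> {?q<..?r}"
        have "g * (4 * B * g) < g * (e t - e a)"
          using big[OF t] g by (intro mult_strict_left_mono) auto
        moreover have "2 * \<gamma> t = g" by (simp add: \<gamma>Si[OF t])
        ultimately show "g * (4 * B * g) < 2 * \<gamma> t * (e t - e a)" by (simp only:)
      qed (use qr in auto)
      also have "\<dots> \<le> (\<Sum>t=a..?r. 2 * \<gamma> t * (e t - e a))"
        unfolding split using \<gamma>i g best a by (auto intro!: sum_nonneg)
      finally show False using regret[of a ?r] a by simp
    qed
    then obtain t where t: "t \<in> {?q<..?r}" "e t \<le> e a + 4 * B * g" by blast
    have "e t \<le> w + 8 * B * c * (1 - 1 / 2 ^ Suc i)"
      using t(2) ea by (simp add: g_def field_simps)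
    with t(1) show ?case by blast
  qed
  from this[of L] obtain t where t: "t \<in> {\<tau> L<..\<tau> (Suc L)}" "e t \<le> w + 8 * B * c * (1 - 1 / 2 ^ L)"
    by auto
  \<comment> \<open>Together with the \<open>B * c / 2\<close> in \<open>w\<close> this stays below
    \<open>9 * B * c\<close>. The last phase is a singleton, so the iterate found is the last
    one.\<close>
  have "8 * B * c * (1 - 1 / 2 ^ L) \<le> 8 * B * c" using B c by (intro mult_left_le) auto
  moreover have "B * c \<ge> 0" using B c by simp
  moreover have "t = \<tau> (Suc L)" using t(1) last by auto
  ultimately show ?thesis using t(2) unfolding w_def by simp
qed

section \<open>Arithmetic of the step-size schedule\<close>

lemma jnn_phases_le: "real T / 2 ^ jnn_phases T \<le> 1"
  unfolding jnn_phases_def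
  by (rule LeastI[of _ T]) (simp add: of_nat_less_two_power less_imp_le)

lemma less_jnn_phases: "i < jnn_phases T \<Longrightarrow> 1 < real T / 2 ^ i"
  unfolding jnn_phases_def by (drule not_less_Least) simp

lemma jnn_time_le: "jnn_time T i \<le> T"
  by (simp add: jnn_time_def)

lemma jnn_time_0 [simp]: "jnn_time T 0 = 0"
  by (simp add: jnn_time_def)

text \<open>The number of iterations remaining after \<open>jnn_time T i\<close> halves in each
  phase, up to rounding; integer inequalities suffice from here on.\<close>

lemma jnn_remaining_halves:
  fixes T i :: nat
  defines "r \<equiv> \<lambda>i. nat \<lceil>real T / 2 ^ i\<rceil>"
  shows "r i \<le> 2 * r (Suc i)" "2 * r (Suc i) \<le> r i + 1"
proof -
  define x where "x = real T / 2 ^ i"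
  have x: "x \<ge> 0" "real T / 2 ^ Suc i = x / 2" by (simp_all add: x_def)
  have "\<lceil>x\<rceil> \<le> 2 * \<lceil>x / 2\<rceil>" by linarith
  moreover have "2 * \<lceil>x / 2\<rceil> \<le> \<lceil>x\<rceil> + 1" by linarith
  moreover have "0 \<le> \<lceil>x\<rceil>" using x by simp
  ultimately show "r i \<le> 2 * r (Suc i)" "2 * r (Suc i) \<le> r i + 1"
    unfolding r_def x(2) x_def[symmetric] by linarith+
qed

lemma jnn_remaining:
  assumes "i \<le> jnn_phases T"
  shows "T = jnn_time T i + nat \<lceil>real T / 2 ^ i\<rceil>"
proof -
  have "real T / 2 ^ i \<le> real T" by (simp add: divide_le_eq mult_le_cancel_left1)
  then have "nat \<lceil>real T / 2 ^ i\<rceil> \<le> T" by linarith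
  then show ?thesis using assms by (simp add: jnn_time_def)
qed

lemma jnn_remaining_last:
  assumes "T \<ge> 1"
  shows "nat \<lceil>real T / 2 ^ jnn_phases T\<rceil> = 1"
proof -
  have "0 < real T / 2 ^ jnn_phases T" using assms by simp
  then have "\<lceil>real T / 2 ^ jnn_phases T\<rceil> = 1" using jnn_phases_le[of T] by linarith
  then show ?thesis by simp
qed

lemma jnn_remaining_ge_2:
  assumes "i < jnn_phases T"
  shows "2 \<le> nat \<lceil>real T / 2 ^ i\<rceil>"
  using less_jnn_phases[OF assms] by linarith

lemma jnn_time_last: "jnn_time T (Suc (jnn_phases T)) = T"
  by (simp add: jnn_time_def)

lemma jnn_time_last_phase:
  assumes "T \<ge> 1"
  shows "Suc (jnn_time T (jnn_phases T)) = T"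
  using jnn_remaining[of "jnn_phases T" T] jnn_remaining_last[OF assms] by simp

lemma jnn_time_less:
  assumes "T \<ge> 1" "i \<le> jnn_phases T"
  shows "jnn_time T i < jnn_time T (Suc i)"
proof (cases "i = jnn_phases T")
  case True
  then show ?thesis using jnn_time_last_phase[OF assms(1)] jnn_time_last[of T] by simp
next
  case False
  then show ?thesis
    using assms jnn_remaining[of i T] jnn_remaining[of "Suc i" T] jnn_remaining_ge_2[of i T]
      jnn_remaining_halves[of T i] by linarith
qed

text \<open>The final phase is treated separately because its endpoint is set to \<open>T\<close>
  rather than given by the ceiling formula.\<close>

lemma jnn_phase_length_ratio:
  assumes "T \<ge> 1" "i < jnn_phases T"
  shows "jnn_time T (Suc i) - jnn_time T i \<le> 3 * (jnn_time T (Suc (Suc i)) - jnn_time T (Suc i))"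
proof (cases "Suc i = jnn_phases T")
  case True
  have "nat \<lceil>real T / 2 ^ i\<rceil> \<le> 2"
    using jnn_remaining_halves(1)[of T i] jnn_remaining_last[OF assms(1)] True by simp
  moreover have "T = jnn_time T i + nat \<lceil>real T / 2 ^ i\<rceil>" using assms by (intro jnn_remaining) simp
  moreover have "Suc (jnn_time T (Suc i)) = T" "jnn_time T (Suc (Suc i)) = T"
    using jnn_time_last_phase[OF assms(1)] jnn_time_last[of T] True by simp_all
  ultimately show ?thesis by linarith
next
  case False
  define a where "a j = nat \<lceil>real T / 2 ^ j\<rceil>" for j
  have *: "2 \<le> a (Suc i)" "T = jnn_time T i + a i" "T = jnn_time T (Suc i) + a (Suc i)"
    "T = jnn_time T (Suc (Suc i)) + a (Suc (Suc i))" "a i \<le> 2 * a (Suc i)"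
    "2 * a (Suc (Suc i)) \<le> a (Suc i) + 1"
    using False assms unfolding a_def
    by (intro jnn_remaining jnn_remaining_ge_2 jnn_remaining_halves; simp)+
  \<comment> \<open>Since \<open>a i \<le> 2 * a (Suc i)\<close>, the claim reduces to
    \<open>3 * a (Suc (Suc i)) \<le> 2 * a (Suc i)\<close>. The halving bound gives this once
    \<open>a (Suc i)\<close> is at least 3; the remaining value 2 leaves
    \<open>a (Suc (Suc i)) \<le> 1\<close>.\<close>
  have "a (Suc (Suc i)) \<le> 1 \<or> 3 \<le> a (Suc i)" using * by linarith
  then have "a i + 3 * a (Suc (Suc i)) \<le> 4 * a (Suc i)" using * by linarith
  then show ?thesis using * by linarith
qed

lemma jnn_first_phase_length: "T \<le> 3 * jnn_time T 1"
proof (cases "jnn_phases T = 0")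
  case True
  then show ?thesis using jnn_time_last[of T] by simp
next
  case False
  then show ?thesis
    using jnn_remaining[of 1 T] jnn_remaining_ge_2[of 0 T] jnn_remaining_halves(2)[of T 0] by simp
qed

lemma jnn_step_eq:
  assumes "i \<le> jnn_phases T" "jnn_time T i < t" "t \<le> jnn_time T (Suc i)"
  shows "jnn_step C T t = C / sqrt (real T) / 2 ^ i"
proof -
  have "1 \<le> t" "t \<le> T" using assms jnn_time_le[of T "Suc i"] by simp_all
  then have "jnn_phase T t = i"
    unfolding jnn_phase_def using jnn_phase_unique assms by (intro the1_equality) auto
  then show ?thesis by (simp add: jnn_step_def field_simps)
qed

text \<open>With base step \<open>C / sqrt T\<close> and a first phase of length at least
  \<open>T / 3\<close>, the initial-distance term and the noise term are both of order
  \<open>1 / sqrt T\<close>.\<close>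

lemma jnn_last_iterate:
  fixes e :: "nat \<Rightarrow> real" and B D C v :: real
  assumes T: "T \<ge> 1" and C: "C > 0" and B: "B \<ge> 0" and D: "D \<ge> 0"
    and regret: "\<And>a b. 1 \<le> a \<Longrightarrow> (\<Sum>t=a..b. 2 * jnn_step C T t * (e t - e a))
      \<le> B * (\<Sum>t=a..b. (jnn_step C T t)\<^sup>2)"
    and regret_start: "\<And>b. (\<Sum>t=1..b. 2 * jnn_step C T t * (e t - v))
      \<le> D + B * (\<Sum>t=1..b. (jnn_step C T t)\<^sup>2)"
  shows "e T - v \<le> (3 * D / (2 * C) + 9 * B * C) / sqrt (real T)"
proof -
  define c where "c = C / sqrt (real T)"
  have c: "c > 0" using C T by (simp add: c_def)
  have "e (jnn_time T (Suc (jnn_phases T))) \<le> v + D / (2 * c * real (jnn_time T 1)) + 9 * B * c"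
  proof (rule phased_steps_last_iterate[where \<tau> = "jnn_time T" and \<gamma> = "jnn_step C T" and e = e,
        OF jnn_time_0 _ _ _ _ c B])
    show "jnn_time T i < jnn_time T (Suc i)" if "i \<le> jnn_phases T" for i
      using T that by (rule jnn_time_less)
    show "jnn_time T (Suc (jnn_phases T)) = Suc (jnn_time T (jnn_phases T))"
      by (simp only: jnn_time_last jnn_time_last_phase[OF T])
    show "jnn_time T (Suc i) - jnn_time T i \<le> 3 * (jnn_time T (Suc (Suc i)) - jnn_time T (Suc i))"
      if "i < jnn_phases T" for i
      using T that by (rule jnn_phase_length_ratio)
    show "jnn_step C T t = c / 2 ^ i"
      if "i \<le> jnn_phases T" "jnn_time T i < t" "t \<le> jnn_time T (Suc i)" for i t
      unfolding c_def using that by (rule jnn_step_eq)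
  qed (rule regret, assumption, rule regret_start)
  then have "e T - v \<le> D / (2 * c * real (jnn_time T 1)) + 9 * B * c" by (simp add: jnn_time_last)
  also have "\<dots> \<le> D / (2 * c * (real T / 3)) + 9 * B * c"
    using jnn_first_phase_length[of T] D c T
    by (intro add_right_mono divide_left_mono mult_left_mono) auto
  also have "D / (2 * c * (real T / 3)) = 3 * D / (2 * C) / sqrt (real T)"
    using C T by (simp add: c_def field_simps)
  also have "9 * B * c = 9 * B * C / sqrt (real T)" by (simp add: c_def)
  finally show ?thesis by (simp only: add_divide_distrib)
qed

theorem theorem4p2:
  fixes F :: "('n::finite \<Rightarrow> 'v) set"
    and V :: "('n \<Rightarrow> 'v) \<Rightarrow> 'v set"
    and k :: nat
    and l u :: "('n \<Rightarrow> 'v) \<Rightarrow> 'v \<Rightarrow> nat"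
    and \<pi> :: "real ^ 'n"
    and s :: nat
    and C :: real
    and PS :: "'n set set"
  assumes inst: "sortition_instance F V k l u"
    and PS: "PS = panels F V k l u"
    and nonempty: "PS \<noteq> {}"
    and target: "\<pi> \<in> rel_interior (selection_polytope PS)"
    and s: "s \<ge> 1"
    and C: "C > 0"
  shows "(\<forall>T\<ge>1. \<forall>\<theta>\<in>set_pmf (fme_iterate PS \<pi> s (jnn_step C T) T).
            is_arg_max (shannon_entropy PS)
              (\<lambda>\<mu>. \<mu> \<in> panel_dists PS \<and>
                   selection_probs PS \<mu> = selection_probs PS (exp_dist PS \<theta>))
              (exp_dist PS \<theta>)) \<and>
         (\<exists>K. \<forall>T\<ge>1.
            measure_pmf.expectation (fme_iterate PS \<pi> s (jnn_step C T) T)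
              (\<lambda>\<theta>. (norm (selection_probs PS (exp_dist PS \<theta>) - \<pi>))\<^sup>2)
            \<le> K / sqrt (real T))"
proof (intro conjI allI ballI impI)
  show "is_arg_max (shannon_entropy PS)
      (\<lambda>\<mu>. \<mu> \<in> panel_dists PS \<and> selection_probs PS \<mu> = selection_probs PS (exp_dist PS \<theta>))
      (exp_dist PS \<theta>)" for \<theta>
    by (rule exp_dist_max_entropy[OF nonempty])
next
  let ?F = "dual_objective PS \<pi>" and ?n = "real CARD('n)"
  obtain x where min: "\<And>\<theta>. ?F x \<le> ?F \<theta>"
    using dual_objective_attains_min[OF nonempty target] by blast
  \<comment> \<open>The constant of \<open>jnn_last_iterate\<close> with
    \<open>D = (norm x)\<^sup>2\<close>, the squared distance from the starting point 0 to the
    minimiser, and \<open>B = (?n + norm \<pi>)\<^sup>2\<close>. Neither involves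
    \<open>T\<close>.\<close>
  define R where "R = 3 * (norm x)\<^sup>2 / (2 * C) + 9 * (?n + norm \<pi>)\<^sup>2 * C"
  have "measure_pmf.expectation (fme_iterate PS \<pi> s (jnn_step C T) T)
      (\<lambda>\<theta>. (norm (selection_probs PS (exp_dist PS \<theta>) - \<pi>))\<^sup>2) \<le> 2 * ?n\<^sup>2 * R / sqrt (real T)"
    if T: "T \<ge> 1" for T
  proof -
    let ?I = "fme_iterate PS \<pi> s (jnn_step C T)"
    have int: "integrable (?I T) h" for h :: "_ \<Rightarrow> real"
      by (intro integrable_measure_pmf_finite finite_set_pmf_fme_iterate)
    have \<gamma>: "jnn_step C T t \<ge> 0" for t using C by (simp add: jnn_step_def)
    \<comment> \<open>The gradient bound is linear in the objective gap, so it passes to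
      expectations and only the expected gap remains to be bounded.\<close>
    have "measure_pmf.expectation (?I T) (\<lambda>\<theta>. (norm (selection_probs PS (exp_dist PS \<theta>) - \<pi>))\<^sup>2)
        \<le> measure_pmf.expectation (?I T) (\<lambda>\<theta>. 2 * ?n\<^sup>2 * (?F \<theta> - ?F x))"
      by (intro integral_mono int norm_gradient_le nonempty min)
    also have "\<dots> = 2 * ?n\<^sup>2 * (measure_pmf.expectation (?I T) ?F - ?F x)"
      by (simp add: int)
    finally have gap: "measure_pmf.expectation (?I T)
        (\<lambda>\<theta>. (norm (selection_probs PS (exp_dist PS \<theta>) - \<pi>))\<^sup>2)
        \<le> 2 * ?n\<^sup>2 * (measure_pmf.expectation (?I T) ?F - ?F x)" .
    have "measure_pmf.expectation (?I T) ?F - ?F x \<le> R / sqrt (real T)"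
      unfolding R_def
    proof (rule jnn_last_iterate[where e = "\<lambda>t. measure_pmf.expectation (?I t) ?F", OF T C])
      show "(\<Sum>t=a..b. 2 * jnn_step C T t *
          (measure_pmf.expectation (?I t) ?F - measure_pmf.expectation (?I a) ?F))
          \<le> (?n + norm \<pi>)\<^sup>2 * (\<Sum>t=a..b. (jnn_step C T t)\<^sup>2)" if "1 \<le> a" for a b
        using that by (rule fme_iterate_regret[OF nonempty s \<gamma>])
      show "(\<Sum>t=1..b. 2 * jnn_step C T t * (measure_pmf.expectation (?I t) ?F - ?F x))
          \<le> (norm x)\<^sup>2 + (?n + norm \<pi>)\<^sup>2 * (\<Sum>t=1..b. (jnn_step C T t)\<^sup>2)" for b
        by (rule fme_iterate_regret_start[OF nonempty s \<gamma>])
    qed simp_all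
    then have "2 * ?n\<^sup>2 * (measure_pmf.expectation (?I T) ?F - ?F x) \<le> 2 * ?n\<^sup>2 * (R / sqrt (real T))"
      by (intro mult_left_mono) auto
    with gap show ?thesis by simp
  qed
  then show "\<exists>K. \<forall>T\<ge>1. measure_pmf.expectation (fme_iterate PS \<pi> s (jnn_step C T) T)
      (\<lambda>\<theta>. (norm (selection_probs PS (exp_dist PS \<theta>) - \<pi>))\<^sup>2) \<le> K / sqrt (real T)"
    by (intro exI[of _ "2 * ?n\<^sup>2 * R"]) simp
qed

end
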